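(* There exist universal constants $c,C,\bar c,\tilde c,\tilde C,c_1>0$, and for every $\beta>1$ a constant $C_\beta>0$ depending only on $\beta$, such that the following holds. Let $k\ge1$ be an integer, $\lambda\ge0$, and let $Z$ be noncentral $\chi^2$ distributed with $k$ degrees of freedom and noncentrality parameter $\lambda$. Then $X=Z-(k+\lambda)$ satisfies $$c\exp\left(-C\frac{x^2}{k+2\lambda}\right)\le\mathbb{P}(X\ge x)\le\exp\left(-\bar c\frac{x^2}{k+2\lambda}\right),\qquad\forall\,0\le x\le k+2\lambda;$$ $$\tilde c\exp(-\tilde Cx)\le\mathbb{P}(X\ge x)\le\exp(-\bar cx),\qquad\forall\,x\ge k+2\lambda;$$ and, for all $\beta>1$, $$c_1\exp\left(-C_\beta\frac{x^2}{k+2\lambda}\right)\le\mathbb{P}(X\le-x)\le\exp\left(-\frac14\frac{x^2}{k+2\lambda}\right),\qquad\forall\,0<x\le\frac{k+\lambda}{\beta}.$$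
   Context: $Z$ is noncentral $\chi^2$ distributed with $k$ degrees of freedom and noncentrality parameter $\lambda$ if $Z=\sum_{i=1}^kZ_i^2$ in distribution, where $Z_i\sim N(\mu_i,1)$ independently and $\sum_{i=1}^k\mu_i^2=\lambda$. *)

theory Defs
  imports "HOL-Probability.Probability"
begin

text \<open>The sample space of the \<open>Y i\<close> is taken to be \<open>nat \<Rightarrow> real\<close> because a definition cannot
  quantify over types. No law is lost: only the joint law of the \<open>Y i\<close> matters, and it is
  realised by the coordinate functions.\<close>

definition noncentral_chi2_law :: "nat \<Rightarrow> real \<Rightarrow> real measure \<Rightarrow> bool" where
  "noncentral_chi2_law k lam Q \<longleftrightarrow>
     (\<exists>(mu :: nat \<Rightarrow> real) (N :: (nat \<Rightarrow> real) measure) (Y :: nat \<Rightarrow> (nat \<Rightarrow> real) \<Rightarrow> real).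
        (\<Sum>i=1..k. (mu i)\<^sup>2) = lam \<and>
        prob_space N \<and>
        prob_space.indep_vars N (\<lambda>_. borel) Y {1..k} \<and>
        (\<forall>i\<in>{1..k}. distributed N lborel (Y i) (normal_density (mu i) 1)) \<and>
        Q = distr N borel (\<lambda>w. \<Sum>i=1..k. (Y i w)\<^sup>2))"

text \<open>A random variable \<open>Z\<close> on an arbitrary space \<open>M\<close> is noncentral \<open>\<chi>\<^sup>2\<close> distributed iff
  \<open>noncentral_chi2_law k lam (distr M borel Z)\<close>. Bounds with universal constants are
  stated for the law, since constants in a statement about \<open>M :: 'a measure\<close> could depend on
  the type \<open>'a\<close>; the following two facts turn them into bounds for \<open>Z\<close>.\<close>

lemma upper_tail_distr:
  assumes "Z \<in> borel_measurable M"
  shows "measure (distr M borel Z) {z. z - m \<ge> x} = measure M {w \<in> space M. Z w - m \<ge> (x::real)}"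
  using assms by (subst measure_distr) (auto intro!: arg_cong[where f = "measure M"])

lemma lower_tail_distr:
  assumes "Z \<in> borel_measurable M"
  shows "measure (distr M borel Z) {z. z - m \<le> x} = measure M {w \<in> space M. Z w - m \<le> (x::real)}"
  using assms by (subst measure_distr) (auto intro!: arg_cong[where f = "measure M"])

end

theory Submission
  imports Defs
begin

text \<open>
  Write \<open>Z = \<Sum> Y\<^sub>i\<^sup>2\<close> with \<open>Y\<^sub>i \<sim> N(\<mu>\<^sub>i, 1)\<close>, \<open>X = Z - (k + \<lambda>)\<close> and \<open>D = k + 2 \<lambda>\<close>, half the
  variance of \<open>X\<close>. All Gaussian-type bounds come from one fact about the moment generating
  function: \<open>ln E (exp (t X))\<close> is comparable to \<open>D t\<^sup>2\<close>. Completing a square gives the cumulant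
  generating function of one centred term \<open>Y\<^sub>i\<^sup>2 - (1 + \<mu>\<^sub>i\<^sup>2)\<close> in closed form, and the mean value
  theorem writes it as \<open>t\<^sup>2 (1 / (1 - 2 \<xi>) + 2 \<mu>\<^sub>i\<^sup>2 / (1 - 2 t))\<close> with \<open>\<xi>\<close> between \<open>0\<close> and \<open>t\<close>. Summing over
  \<open>i\<close>, the exponent of \<open>X\<close> lies between \<open>2/3 D t\<^sup>2\<close> and \<open>2 D t\<^sup>2\<close> for \<open>\<bar>t\<bar> \<le> 1/4\<close>, and is at most \<open>D t\<^sup>2\<close>
  for every \<open>t \<le> 0\<close>.

  The upper bounds on the tails are then Chernoff bounds; the last inequality, optimised in \<open>t\<close>, is
  what produces the constant \<open>1/4\<close> on the lower tail.

  For the lower bounds the same estimates are run through the Paley-Zygmund inequality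
  (\<open>paley_zygmund\<close>) applied to \<open>exp (t X)\<close>: with probability at least
  \<open>(E exp (t X))\<^sup>2 / (4 E exp (2 t X)) \<ge> exp (- O(D t\<^sup>2))\<close> the variable \<open>exp (t X)\<close> is at least half its
  mean, which forces \<open>X \<ge> 2/3 D t - ln 2 / t\<close>. Taking \<open>t\<close> of order \<open>x / D + 1 / sqrt D\<close> gives
  \<open>reverse_chernoff\<close>, on the upper and, by \<open>X \<mapsto> -X\<close>, on the lower tail. It needs \<open>t\<close> to stay in the
  range of the estimates, that is, \<open>D\<close> to exceed an absolute constant and \<open>x / D\<close> to be small.

  In all other cases \<open>x\<^sup>2 / D\<close> is at least of order \<open>D\<close>, or \<open>D\<close> is bounded, and one can afford to lose a
  factor exponential in \<open>D\<close>. On the upper tail a single coordinate suffices: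
  \<open>Y\<^sub>1\<^sup>2 \<ge> k + \<lambda> + x\<close> has probability at least \<open>exp (- 3 - (k + \<lambda> + x))\<close> (\<open>crude_upper_tail\<close>). On the lower
  tail, \<open>x \<le> (k + \<lambda>) / \<beta>\<close> leaves room for \<open>Y\<^sub>i\<^sup>2 \<le> \<delta> (1 + \<mu>\<^sub>i\<^sup>2)\<close> to hold simultaneously for all \<open>i\<close>,
  where \<open>\<delta> = 1 - 1 / \<beta>\<close>, and by independence this has probability at least \<open>exp (- K\<^sub>\<delta> D)\<close>
  (\<open>crude_lower_tail\<close>); this is the only source of the dependence on \<open>\<beta>\<close>.
\<close>

section \<open>The cumulant generating function of a squared Gaussian\<close>

text \<open>The logarithm of \<open>E (exp (t (Y\<^sup>2 - (1 + m\<^sup>2))))\<close> for \<open>Y \<sim> N(m, 1)\<close> and \<open>t < 1/2\<close>, in closed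
  form; \<open>1 + m\<^sup>2\<close> is the mean of \<open>Y\<^sup>2\<close>.\<close>

definition centred_square_cgf :: "real \<Rightarrow> real \<Rightarrow> real" where
  "centred_square_cgf m t = - t - ln (1 - 2 * t) / 2 + 2 * m\<^sup>2 * t\<^sup>2 / (1 - 2 * t)"

lemma gaussian_square_mgf:
  fixes Y :: "'a \<Rightarrow> real"
  assumes Y: "distributed M lborel Y (normal_density m 1)" and t: "t < 1 / 2"
  shows "has_bochner_integral M (\<lambda>w. exp (t * ((Y w)\<^sup>2 - (1 + m\<^sup>2)))) (exp (centred_square_cgf m t))"
proof -
  define r where "r = 1 - 2 * t"
  have r: "r > 0" and t_eq: "t = (1 - r) / 2"
    using t by (auto simp: r_def)
  have sqrt_eq: "sqrt (2 * pi * (1 / sqrt r)\<^sup>2) = sqrt (2 * pi) / sqrt r"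
    using r by (simp add: power_divide real_sqrt_divide)
  have sqrt_exp: "1 / sqrt r = exp (- ln r / 2)"
  proof -
    have "sqrt r = exp (ln r / 2)"
      using r by (intro real_sqrt_unique) (auto simp: power2_eq_square exp_add[symmetric])
    then show ?thesis by (simp add: exp_minus field_simps)
  qed
  have cgf: "centred_square_cgf m t = (- ln r / 2) + (- t + 2 * m\<^sup>2 * t\<^sup>2 / r)"
    by (simp add: centred_square_cgf_def r_def)
  \<comment> \<open>Completing the square: the weight turns the density into that of \<open>N(m / r, 1 / r)\<close>.\<close>
  have square: "normal_density m 1 y * exp (t * (y\<^sup>2 - (1 + m\<^sup>2)))
      = exp (centred_square_cgf m t) * normal_density (m / r) (1 / sqrt r) y" for y
  proof -
    have "- (y - m)\<^sup>2 / 2 + t * (y\<^sup>2 - (1 + m\<^sup>2))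
        = - t + 2 * m\<^sup>2 * t\<^sup>2 / r + (- (y - m / r)\<^sup>2 / (2 * (1 / sqrt r)\<^sup>2))"
      using r unfolding t_eq by (simp add: field_simps power2_eq_square)
    then have "exp (- (y - m)\<^sup>2 / 2) * exp (t * (y\<^sup>2 - (1 + m\<^sup>2)))
        = exp (- t + 2 * m\<^sup>2 * t\<^sup>2 / r) * exp (- (y - m / r)\<^sup>2 / (2 * (1 / sqrt r)\<^sup>2))"
      by (simp only: exp_add[symmetric])
    moreover have "exp (- ln r / 2) * (1 / (sqrt (2 * pi) / sqrt r)) = 1 / sqrt (2 * pi)"
      unfolding sqrt_exp[symmetric] using r by simp
    ultimately show ?thesis
      unfolding normal_density_def sqrt_eq cgf exp_add[of "- ln r / 2"]
      by (simp add: algebra_simps)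
  qed
  have "integrable lborel (\<lambda>y. normal_density m 1 y * exp (t * (y\<^sup>2 - (1 + m\<^sup>2))))"
    unfolding square using r by (intro integrable_mult_right integrable_normal_density) auto
  then have "integrable M (\<lambda>w. exp (t * ((Y w)\<^sup>2 - (1 + m\<^sup>2))))"
    by (subst (asm) distributed_integrable[OF Y]) auto
  moreover have "(\<integral>w. exp (t * ((Y w)\<^sup>2 - (1 + m\<^sup>2))) \<partial>M)
      = (\<integral>y. normal_density m 1 y * exp (t * (y\<^sup>2 - (1 + m\<^sup>2))) \<partial>lborel)"
    by (subst distributed_integral[OF Y, symmetric]) auto
  moreover have "\<dots> = exp (centred_square_cgf m t)"
    unfolding square using r by simp
  ultimately show ?thesis by (simp add: has_bochner_integral_iff)
qed

text \<open>Cauchy's mean value theorem for the left-hand side against \<open>t\<^sup>2\<close>. The form of the remainder is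
  chosen to match the coefficient \<open>1 / (1 - 2 t)\<close> of the noncentral term, so that both
  parts of the cumulant generating function can be compared with the same multiple of \<open>t\<^sup>2\<close>.\<close>

lemma ln_mean_value_quadratic:
  fixes t :: real
  assumes t: "t < 1 / 2"
  obtains \<xi> where "min 0 t \<le> \<xi>" "\<xi> \<le> max 0 t" "- t - ln (1 - 2 * t) / 2 = t\<^sup>2 / (1 - 2 * \<xi>)"
proof -
  define g :: "real \<Rightarrow> real" where "g = (\<lambda>s. - s - ln (1 - 2 * s) / 2)"
  have dg: "(g has_real_derivative 2 * s / (1 - 2 * s)) (at s)" if "s < 1 / 2" for s
    unfolding g_def using that by (auto intro!: derivative_eq_intros simp: field_simps)
  have dq: "((\<lambda>s. s\<^sup>2) has_real_derivative 2 * s) (at s)" for s :: real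
    by (auto intro!: derivative_eq_intros)
  have mv: "\<exists>\<xi>. a < \<xi> \<and> \<xi> < b \<and> (g b - g a) * (2 * \<xi>) = (b\<^sup>2 - a\<^sup>2) * (2 * \<xi> / (1 - 2 * \<xi>))"
    if "a < b" "b < 1 / 2" for a b
    using that
    by (intro GMVT' DERIV_isCont[OF dg] DERIV_isCont[OF dq] dg dq) auto
  have g0: "g 0 = 0" by (simp add: g_def)
  consider "t = 0" | "t > 0" | "t < 0" by linarith
  then show thesis
  proof cases
    case 1
    then show thesis by (intro that[of 0]) auto
  next
    case 2
    then obtain \<xi> where "0 < \<xi>" "\<xi> < t" "g t * (2 * \<xi>) = t\<^sup>2 * (2 * \<xi> / (1 - 2 * \<xi>))"
      using mv[of 0 t] t g0 by auto
    then have "(2 * \<xi>) * g t = (2 * \<xi>) * (t\<^sup>2 / (1 - 2 * \<xi>))" by (simp add: mult_ac)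
    then have "g t = t\<^sup>2 / (1 - 2 * \<xi>)" using \<open>0 < \<xi>\<close> by (simp only: mult_cancel_left) simp
    then show thesis using \<open>0 < \<xi>\<close> \<open>\<xi> < t\<close> by (intro that[of \<xi>]) (auto simp: g_def)
  next
    case 3
    then obtain \<xi> where "t < \<xi>" "\<xi> < 0" "g t * (2 * \<xi>) = t\<^sup>2 * (2 * \<xi> / (1 - 2 * \<xi>))"
      using mv[of t 0] g0 by auto
    then have "(2 * \<xi>) * g t = (2 * \<xi>) * (t\<^sup>2 / (1 - 2 * \<xi>))" by (simp add: mult_ac)
    then have "g t = t\<^sup>2 / (1 - 2 * \<xi>)" using \<open>\<xi> < 0\<close> by (simp only: mult_cancel_left) simp
    then show thesis using \<open>\<xi> < 0\<close> \<open>t < \<xi>\<close> by (intro that[of \<xi>]) (auto simp: g_def)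
  qed
qed


text \<open>The function \<open>\<xi> \<mapsto> c (1 - 2 \<xi>)\<close> is affine, so the conditions on \<open>c\<close> at the endpoints \<open>0\<close> and \<open>t\<close> carry
  over to the unknown intermediate point. This treats both signs of \<open>t\<close> at once.\<close>

lemma centred_square_cgf_lower:
  assumes t: "t < 1 / 2" and c: "0 \<le> c" "c \<le> 1" "c * (1 - 2 * t) \<le> 1"
  shows "c * (1 + 2 * m\<^sup>2) * t\<^sup>2 \<le> centred_square_cgf m t"
proof -
  obtain \<xi> where \<xi>: "min 0 t \<le> \<xi>" "\<xi> \<le> max 0 t"
      "- t - ln (1 - 2 * t) / 2 = t\<^sup>2 / (1 - 2 * \<xi>)"
    using ln_mean_value_quadratic[OF t] by blast
  have "c * (1 - 2 * \<xi>) \<le> 1"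
  proof (cases "t \<ge> 0")
    case True
    then have "c * (1 - 2 * \<xi>) \<le> c * 1" using \<xi> c by (intro mult_left_mono) auto
    then show ?thesis using c by simp
  next
    case False
    then have "c * (1 - 2 * \<xi>) \<le> c * (1 - 2 * t)" using \<xi> c by (intro mult_left_mono) auto
    then show ?thesis using c by simp
  qed
  then have "c \<le> 1 / (1 - 2 * \<xi>)" "c \<le> 1 / (1 - 2 * t)"
    using t \<xi> c by (auto simp: field_simps max_def split: if_splits)
  then have "t\<^sup>2 * c + 2 * m\<^sup>2 * t\<^sup>2 * c \<le> t\<^sup>2 * (1 / (1 - 2 * \<xi>)) + 2 * m\<^sup>2 * t\<^sup>2 * (1 / (1 - 2 * t))"
    by (intro add_mono mult_left_mono) auto
  moreover have "centred_square_cgf m t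
      = t\<^sup>2 * (1 / (1 - 2 * \<xi>)) + 2 * m\<^sup>2 * t\<^sup>2 * (1 / (1 - 2 * t))"
    unfolding centred_square_cgf_def \<xi>(3) by simp
  moreover have "c * (1 + 2 * m\<^sup>2) * t\<^sup>2 = t\<^sup>2 * c + 2 * m\<^sup>2 * t\<^sup>2 * c"
    by (simp add: algebra_simps)
  ultimately show ?thesis by simp
qed

lemma centred_square_cgf_upper:
  assumes t: "t < 1 / 2" and c: "1 \<le> c" "1 \<le> c * (1 - 2 * t)"
  shows "centred_square_cgf m t \<le> c * (1 + 2 * m\<^sup>2) * t\<^sup>2"
proof -
  obtain \<xi> where \<xi>: "min 0 t \<le> \<xi>" "\<xi> \<le> max 0 t"
      "- t - ln (1 - 2 * t) / 2 = t\<^sup>2 / (1 - 2 * \<xi>)"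
    using ln_mean_value_quadratic[OF t] by blast
  have "1 \<le> c * (1 - 2 * \<xi>)"
  proof (cases "t \<ge> 0")
    case True
    then have "c * (1 - 2 * t) \<le> c * (1 - 2 * \<xi>)" using \<xi> c True by (intro mult_left_mono) auto
    then show ?thesis using c by linarith
  next
    case False
    then have "c * 1 \<le> c * (1 - 2 * \<xi>)" using \<xi> c by (intro mult_left_mono) auto
    then show ?thesis using c by linarith
  qed
  then have "1 / (1 - 2 * \<xi>) \<le> c" "1 / (1 - 2 * t) \<le> c"
    using t \<xi> c by (auto simp: field_simps max_def split: if_splits)
  then have "t\<^sup>2 * (1 / (1 - 2 * \<xi>)) + 2 * m\<^sup>2 * t\<^sup>2 * (1 / (1 - 2 * t)) \<le> t\<^sup>2 * c + 2 * m\<^sup>2 * t\<^sup>2 * c"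
    by (intro add_mono mult_left_mono) auto
  moreover have "centred_square_cgf m t
      = t\<^sup>2 * (1 / (1 - 2 * \<xi>)) + 2 * m\<^sup>2 * t\<^sup>2 * (1 / (1 - 2 * t))"
    unfolding centred_square_cgf_def \<xi>(3) by simp
  moreover have "c * (1 + 2 * m\<^sup>2) * t\<^sup>2 = t\<^sup>2 * c + 2 * m\<^sup>2 * t\<^sup>2 * c"
    by (simp add: algebra_simps)
  ultimately show ?thesis by simp
qed

section \<open>Tail bounds from the moment generating function\<close>

lemma (in prob_space) chernoff_bound:
  fixes X :: "'a \<Rightarrow> real"
  assumes "s > 0" "has_bochner_integral M (\<lambda>w. exp (s * X w)) v"
  shows "prob {w \<in> space M. X w \<ge> x} \<le> exp (- s * x) * v"
proof -
  have *: "integrable M (\<lambda>w. exp (s * X w))" "(\<integral>w. exp (s * X w) \<partial>M) = v"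
    using assms(2) by (auto simp: has_bochner_integral_iff)
  have "set_integrable M (space M) (\<lambda>w. exp (s * X w))"
    unfolding set_integrable_def by (rule integrable_mult_indicator) (auto simp: *)
  then show ?thesis
    using Chernoff_ineq_ge[OF assms(1), of "space M" X x] by (simp add: set_integral_space *)
qed

lemma (in prob_space) paley_zygmund:
  fixes W :: "'a \<Rightarrow> real"
  assumes W: "integrable M W" "integrable M (\<lambda>w. (W w)\<^sup>2)" and pos: "expectation W > 0"
  shows "(expectation W)\<^sup>2 / 4
    \<le> expectation (\<lambda>w. (W w)\<^sup>2) * prob {w \<in> space M. W w \<ge> expectation W / 2}"
proof -
  define m where "m = expectation W"
  define S where "S = expectation (\<lambda>w. (W w)\<^sup>2)"
  define A where "A = {w \<in> space M. W w \<ge> m / 2}"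
  have [measurable]: "W \<in> borel_measurable M" using W by auto
  have [measurable]: "A \<in> events" unfolding A_def by measurable
  have m: "m > 0" using pos by (simp add: m_def)
  have "S \<ge> 0" unfolding S_def by simp
  \<comment> \<open>Off the event \<open>W\<close> is below half its mean; on it \<open>W \<le> r W\<^sup>2 + 1 / (4 r)\<close>. The free
    parameter \<open>r\<close> replaces the Cauchy-Schwarz inequality.\<close>
  have key: "m / 2 \<le> r * S + prob A / (4 * r)" if r: "r > 0" for r
  proof -
    have "W w \<le> m / 2 + (r * (W w)\<^sup>2 + indicator A w / (4 * r))" if "w \<in> space M" for w
    proof (cases "w \<in> A")
      case True
      have "0 \<le> (2 * r * W w - 1)\<^sup>2 / (4 * r)" using r by simp
      also have "\<dots> = r * (W w)\<^sup>2 + 1 / (4 * r) - W w"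
        using r by (simp add: field_simps power2_eq_square)
      finally show ?thesis using True m by simp
    next
      case False
      then have "W w < m / 2" using that by (auto simp: A_def)
      moreover have "0 \<le> r * (W w)\<^sup>2" using r by simp
      ultimately show ?thesis using False by simp
    qed
    then have "m \<le> expectation (\<lambda>w. m / 2 + (r * (W w)\<^sup>2 + indicator A w / (4 * r)))"
      unfolding m_def using W by (intro integral_mono) (auto simp: emeasure_eq_measure)
    also have "\<dots> = m / 2 + (r * S + prob A / (4 * r))"
      using W by (simp add: S_def prob_space emeasure_eq_measure)
    finally show ?thesis by simp
  qed
  have "S > 0"
  proof (rule ccontr)
    assume "\<not> S > 0"
    then have "S = 0" using \<open>S \<ge> 0\<close> by simp
    then have "m / 2 \<le> prob A * m / 4" using key[of "1 / m"] m by simp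
    also have "\<dots> \<le> 1 * m / 4" using m prob_le_1[of A] by (intro divide_right_mono mult_right_mono) auto
    finally show False using m by simp
  qed
  then have "m / 2 \<le> m / 4 + prob A * S / m"
    using key[of "m / (4 * S)"] m by simp
  then have "m\<^sup>2 / 4 \<le> S * prob A"
    using m by (simp add: field_simps power2_eq_square)
  then show ?thesis by (simp add: m_def S_def A_def)
qed

text \<open>Two-sided control of the moment generating function gives a lower bound on the tail, because
  Paley-Zygmund for \<open>exp (t X)\<close> involves only its values at \<open>t\<close> and \<open>2 t\<close>. The thresholds \<open>768\<close> and
  \<open>D / 48\<close> keep \<open>2 t\<close> below \<open>1 / 4\<close>.\<close>

lemma (in prob_space) reverse_chernoff:
  fixes X :: "'a \<Rightarrow> real"
  assumes D: "D \<ge> 768" and x: "0 \<le> x" "x \<le> D / 48"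
    and int: "\<And>t. 0 < t \<Longrightarrow> t \<le> 1 / 4 \<Longrightarrow> integrable M (\<lambda>w. exp (t * X w))"
    and lower: "\<And>t. 0 < t \<Longrightarrow> t \<le> 1 / 4 \<Longrightarrow> exp (2 / 3 * D * t\<^sup>2) \<le> expectation (\<lambda>w. exp (t * X w))"
    and upper: "\<And>t. 0 < t \<Longrightarrow> t \<le> 1 / 4 \<Longrightarrow> expectation (\<lambda>w. exp (t * X w)) \<le> exp (2 * D * t\<^sup>2)"
  shows "exp (- 44 - 126 * (x\<^sup>2 / D)) \<le> prob {w \<in> space M. X w \<ge> x}"
proof -
  \<comment> \<open>The event found below gives \<open>X \<ge> 2/3 D t - 1 / t\<close>. The first summand makes \<open>D t / 3 \<ge> x\<close>; the second
    makes \<open>D t\<^sup>2 \<ge> 3\<close>, so that the other \<open>D t / 3\<close> absorbs \<open>1 / t\<close>.\<close>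
  define t where "t = 3 * x / D + sqrt (3 / D)"
  have "sqrt (3 / D) \<le> sqrt ((1 / 16)\<^sup>2)"
    using D by (intro real_sqrt_le_mono) (simp add: field_simps power2_eq_square)
  then have "sqrt (3 / D) \<le> 1 / 16" by (simp only: real_sqrt_abs)
  moreover have "3 * x / D \<le> 1 / 16" "3 * x / D \<ge> 0" using x D by (auto simp: field_simps)
  moreover have "sqrt (3 / D) > 0" using D by simp
  ultimately have t: "t > 0" "t \<le> 1 / 8" "3 * x / D \<le> t" "sqrt (3 / D) \<le> t"
    unfolding t_def by linarith+
  have "(sqrt (3 / D))\<^sup>2 \<le> t\<^sup>2" using t D by (intro power_mono) auto
  then have t2: "D * t\<^sup>2 \<ge> 3" using D by (simp add: field_simps)
  have t2_upper: "D * t\<^sup>2 \<le> 18 * (x\<^sup>2 / D) + 6"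
  proof -
    have "t\<^sup>2 \<le> 2 * (3 * x / D)\<^sup>2 + 2 * (sqrt (3 / D))\<^sup>2"
      unfolding t_def using zero_le_power2[of "3 * x / D - sqrt (3 / D)"]
      by (simp only: power2_sum power2_diff)
    then have "t\<^sup>2 \<le> 18 * x\<^sup>2 / D\<^sup>2 + 6 / D"
      using D by (simp add: power_divide power_mult_distrib)
    then have "D * t\<^sup>2 \<le> D * (18 * x\<^sup>2 / D\<^sup>2 + 6 / D)" using D by (intro mult_left_mono) auto
    also have "\<dots> = 18 * (x\<^sup>2 / D) + 6" using D by (simp add: field_simps power2_eq_square)
    finally show ?thesis .
  qed
  define E where "E = expectation (\<lambda>w. exp (t * X w))"
  define A where "A = {w \<in> space M. exp (t * X w) \<ge> E / 2}"
  have E: "exp (2 / 3 * D * t\<^sup>2) \<le> E" unfolding E_def using t by (intro lower) auto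
  have Epos: "E > 0" using E exp_gt_zero[of "2 / 3 * D * t\<^sup>2"] by linarith
  have sq: "(\<lambda>w. (exp (t * X w))\<^sup>2) = (\<lambda>w. exp ((2 * t) * X w))"
    by (auto simp: power2_eq_square exp_add[symmetric] algebra_simps)
  have "expectation (\<lambda>w. exp ((2 * t) * X w)) \<le> exp (2 * D * (2 * t)\<^sup>2)"
    using t by (intro upper) auto
  then have second: "expectation (\<lambda>w. (exp (t * X w))\<^sup>2) \<le> exp (8 * (D * t\<^sup>2))"
    unfolding sq by (simp add: power2_eq_square algebra_simps)
  \<comment> \<open>Measurability of \<open>X\<close> is recovered from that of \<open>exp (t X)\<close>.\<close>
  have [measurable]: "X \<in> borel_measurable M"
  proof -
    have "(\<lambda>w. ln (exp (t * X w)) / t) \<in> borel_measurable M"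
      using int[of t] t by (intro borel_measurable_divide borel_measurable_ln) auto
    then show ?thesis using t by simp
  qed
  have "exp (4 / 3 * (D * t\<^sup>2)) / 4 \<le> E\<^sup>2 / 4"
    using power_mono[OF E, of 2] by (simp add: power2_eq_square exp_add[symmetric])
  also have "\<dots> \<le> expectation (\<lambda>w. (exp (t * X w))\<^sup>2) * prob A"
    unfolding E_def A_def using t Epos
    by (intro paley_zygmund) (auto simp: sq E_def intro: int)
  also have "\<dots> \<le> exp (8 * (D * t\<^sup>2)) * prob A"
    by (intro mult_right_mono second) auto
  finally have "exp (- (8 * (D * t\<^sup>2))) * (exp (4 / 3 * (D * t\<^sup>2)) / 4)
      \<le> exp (- (8 * (D * t\<^sup>2))) * (exp (8 * (D * t\<^sup>2)) * prob A)"
    by (intro mult_left_mono) auto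
  then have "exp (- 20 / 3 * (D * t\<^sup>2)) / 4 \<le> prob A"
    by (simp add: mult.assoc[symmetric] exp_add[symmetric])
  moreover have "exp (- 44 - 126 * (x\<^sup>2 / D)) \<le> exp (- 20 / 3 * (D * t\<^sup>2)) * exp (- 2)"
    unfolding exp_add[symmetric] using t2_upper t2 by simp
  moreover have "exp (- 2 :: real) \<le> 1 / 4"
  proof -
    have "(2::real)\<^sup>2 \<le> (exp 1)\<^sup>2" using exp_ge_add_one_self[of 1] by (intro power_mono) auto
    then show ?thesis by (simp add: exp_minus power2_eq_square exp_add[symmetric] field_simps)
  qed
  then have "exp (- 20 / 3 * (D * t\<^sup>2)) * exp (- 2) \<le> exp (- 20 / 3 * (D * t\<^sup>2)) * (1 / 4)"
    by (intro mult_left_mono) auto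
  moreover have "prob A \<le> prob {w \<in> space M. X w \<ge> x}"
  proof (rule finite_measure_mono)
    show "A \<subseteq> {w \<in> space M. X w \<ge> x}"
    proof
      fix w assume w: "w \<in> A"
      have "exp (t * X w) \<ge> exp (2 / 3 * D * t\<^sup>2) / 2"
        using w E by (auto simp: A_def)
      also have "exp (2 / 3 * D * t\<^sup>2) / 2 \<ge> exp (2 / 3 * D * t\<^sup>2) * exp (- 1)"
        using exp_ge_add_one_self[of 1] by (simp add: exp_minus field_simps)
      finally have "exp (2 / 3 * D * t\<^sup>2 + - 1) \<le> exp (t * X w)" by (simp only: exp_add)
      then have "2 / 3 * (D * t\<^sup>2) - 1 \<le> t * X w" by simp
      moreover have "t * x \<le> D * t\<^sup>2 / 3"
        using t D mult_left_mono[of "3 * x / D" t "D * t / 3"]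
        by (simp add: field_simps power2_eq_square)
      ultimately have "t * x \<le> t * X w" using t2 by linarith
      then show "w \<in> {w \<in> space M. X w \<ge> x}" using w t by (auto simp: A_def)
    qed
  qed measurable
  ultimately show ?thesis by linarith
qed

section \<open>Direct bounds from the Gaussian density\<close>

lemma (in prob_space) unit_normal_interval:
  assumes Y: "distributed M lborel Y (normal_density m 1)" and "a \<le> b"
    and near: "\<And>y. a \<le> y \<Longrightarrow> y \<le> b \<Longrightarrow> (y - m)\<^sup>2 / 2 \<le> r"
  shows "(b - a) * exp (- 2 - r) \<le> prob {w \<in> space M. Y w \<in> {a..b}}"
proof -
  have density: "exp (- 2 - r) \<le> normal_density m 1 y" if "a \<le> y" "y \<le> b" for y
  proof -
    have "sqrt (2 * pi) \<le> sqrt (3\<^sup>2)"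
      using pi_less_4 by (intro real_sqrt_le_mono) simp
    also have "\<dots> \<le> exp 2" using exp_ge_add_one_self[of 2] by simp
    finally have "exp (- 2) \<le> 1 / sqrt (2 * pi)" by (simp add: exp_minus field_simps)
    then have "exp (- 2) * exp (- r) \<le> 1 / sqrt (2 * pi) * exp (- (y - m)\<^sup>2 / 2)"
      using near[OF that] by (intro mult_mono) auto
    then show ?thesis by (simp add: normal_density_def exp_add[symmetric])
  qed
  have "ennreal ((b - a) * exp (- 2 - r))
      = (\<integral>\<^sup>+y. ennreal (exp (- 2 - r)) * indicator {a..b} y \<partial>lborel)"
    using \<open>a \<le> b\<close> by (subst nn_integral_cmult_indicator) (auto simp: ennreal_mult'[symmetric] mult.commute)
  also have "\<dots> \<le> (\<integral>\<^sup>+y. ennreal (normal_density m 1 y) * indicator {a..b} y \<partial>lborel)"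
    using density by (intro nn_integral_mono) (auto split: split_indicator intro!: ennreal_leI)
  also have "\<dots> = emeasure M (Y -` {a..b} \<inter> space M)"
    by (rule distributed_emeasure[OF Y, symmetric]) simp
  also have "Y -` {a..b} \<inter> space M = {w \<in> space M. Y w \<in> {a..b}}" by auto
  finally show ?thesis using \<open>a \<le> b\<close>
    by (simp add: emeasure_eq_measure)
qed

lemma (in prob_space) unit_normal_square_large:
  assumes Y: "distributed M lborel Y (normal_density m 1)" and s: "s \<ge> 0"
  shows "exp (- 3 - s) \<le> prob {w \<in> space M. (Y w)\<^sup>2 \<ge> s}"
proof -
  have [measurable]: "Y \<in> borel_measurable M" using Y by (simp add: distributed_def)
  have bound: "y\<^sup>2 / 2 \<le> 1 + s" if "\<bar>y\<bar> \<le> sqrt s + 1" for y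
  proof -
    have "y\<^sup>2 \<le> (sqrt s + 1)\<^sup>2" using that s by (intro abs_le_square_iff[THEN iffD1]) auto
    also have "\<dots> = s + 2 * sqrt s + 1" using s by (simp add: power2_sum)
    also have "\<dots> \<le> 2 * s + 2"
      using s zero_le_power2[of "sqrt s - 1"] by (simp add: power2_diff)
    finally show ?thesis by simp
  qed
  have large: "s \<le> y\<^sup>2" if "\<bar>y\<bar> \<ge> sqrt s" for y
    using that s abs_le_square_iff[of "sqrt s" y] by simp
  have sub: "prob {w \<in> space M. Y w \<in> {a..b}} \<le> prob {w \<in> space M. (Y w)\<^sup>2 \<ge> s}"
    if "\<And>y. a \<le> y \<Longrightarrow> y \<le> b \<Longrightarrow> \<bar>y\<bar> \<ge> sqrt s" for a b
    using that by (intro finite_measure_mono) (auto intro!: large)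
  \<comment> \<open>Moving from \<open>m\<close> away from the origin by \<open>sqrt s\<close> gives a unit interval on which the
    square exceeds \<open>s\<close>, at a distance from \<open>m\<close> that does not grow with \<open>m\<close>.\<close>
  have root: "sqrt s \<ge> 0" using s by simp
  show ?thesis
  proof (cases "m \<ge> 0")
    case True
    have "(m + sqrt s + 1 - (m + sqrt s)) * exp (- 2 - (1 + s))
        \<le> prob {w \<in> space M. Y w \<in> {m + sqrt s..m + sqrt s + 1}}"
      using root by (intro unit_normal_interval[OF Y] bound) linarith+
    also have "\<dots> \<le> prob {w \<in> space M. (Y w)\<^sup>2 \<ge> s}" using True s by (intro sub) auto
    finally show ?thesis by simp
  next
    case False
    have "(m - sqrt s - (m - sqrt s - 1)) * exp (- 2 - (1 + s))
        \<le> prob {w \<in> space M. Y w \<in> {m - sqrt s - 1..m - sqrt s}}"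
      using root by (intro unit_normal_interval[OF Y] bound) linarith+
    also have "\<dots> \<le> prob {w \<in> space M. (Y w)\<^sup>2 \<ge> s}"
    proof (intro sub)
      fix y assume "y \<le> m - sqrt s"
      then show "sqrt s \<le> \<bar>y\<bar>" using False s by (simp add: abs_if)
    qed
    finally show ?thesis by simp
  qed
qed

text \<open>What matters is that the exponent is a multiple of \<open>1 + 2 m\<^sup>2\<close>: over all coordinates these
  add up to \<open>k + 2 \<lambda>\<close>. The interval \<open>[- d, d]\<close> stays inside the event and within distance
  of order \<open>1 + \<bar>m\<bar>\<close> of the mean.\<close>

lemma (in prob_space) unit_normal_square_small:
  assumes Y: "distributed M lborel Y (normal_density m 1)" and d: "0 < d" "d \<le> 1"
  shows "exp (- ((3 + 1 / d) * (1 + 2 * m\<^sup>2))) \<le> prob {w \<in> space M. (Y w)\<^sup>2 \<le> d * (1 + m\<^sup>2)}"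
proof -
  have [measurable]: "Y \<in> borel_measurable M" using Y by (simp add: distributed_def)
  have "exp (- (1 / d)) \<le> d"
    using exp_ge_add_one_self[of "1 / d"] d by (simp add: exp_minus field_simps)
  then have "exp (- (1 / d)) * exp (- 2 - (1 + m\<^sup>2)) \<le> (d - (- d)) * exp (- 2 - (1 + m\<^sup>2))"
    using d by (intro mult_right_mono) auto
  also have "\<dots> \<le> prob {w \<in> space M. Y w \<in> {-d..d}}"
  proof (rule unit_normal_interval[OF Y])
    fix y assume "- d \<le> y" "y \<le> d"
    then have "y\<^sup>2 \<le> 1\<^sup>2" using d by (intro abs_le_square_iff[THEN iffD1]) auto
    then show "(y - m)\<^sup>2 / 2 \<le> 1 + m\<^sup>2"
      using zero_le_power2[of "y + m"] by (simp add: power2_sum power2_diff)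
  qed (use d in auto)
  also have "\<dots> \<le> prob {w \<in> space M. (Y w)\<^sup>2 \<le> d * (1 + m\<^sup>2)}"
  proof (rule finite_measure_mono)
    have "y\<^sup>2 \<le> d * (1 + m\<^sup>2)" if "- d \<le> y" "y \<le> d" for y
    proof -
      have "y\<^sup>2 \<le> d\<^sup>2" using that d by (intro abs_le_square_iff[THEN iffD1]) auto
      also have "\<dots> \<le> d * (1 + m\<^sup>2)"
        unfolding power2_eq_square[of d] using d by (intro mult_left_mono) (auto intro: order_trans)
      finally show ?thesis .
    qed
    then show "{w \<in> space M. Y w \<in> {-d..d}} \<subseteq> {w \<in> space M. (Y w)\<^sup>2 \<le> d * (1 + m\<^sup>2)}" by auto
  qed measurable
  finally have "exp (- (1 / d) + (- 2 - (1 + m\<^sup>2))) \<le> prob {w \<in> space M. (Y w)\<^sup>2 \<le> d * (1 + m\<^sup>2)}"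
    by (simp only: exp_add)
  moreover have "m\<^sup>2 \<le> (3 + 1 / d) * (2 * m\<^sup>2)"
    using d mult_right_mono[of 1 "(3 + 1 / d) * 2" "m\<^sup>2"] by (simp add: field_simps)
  then have "- ((3 + 1 / d) * (1 + 2 * m\<^sup>2)) \<le> - (1 / d) + (- 2 - (1 + m\<^sup>2))"
    by (simp only: distrib_left) simp
  ultimately show ?thesis by (meson exp_le_cancel_iff order_trans)
qed

section \<open>Sums of squares of independent Gaussians\<close>

locale noncentral_chi2 = prob_space N for N :: "'a measure" +
  fixes k :: nat and mu :: "nat \<Rightarrow> real" and Y :: "nat \<Rightarrow> 'a \<Rightarrow> real" and lam :: real
  assumes k: "k \<ge> 1"
    and lam: "lam = (\<Sum>i=1..k. (mu i)\<^sup>2)"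
    and indep: "indep_vars (\<lambda>_. borel) Y {1..k}"
    and normal: "\<And>i. i \<in> {1..k} \<Longrightarrow> distributed N lborel (Y i) (normal_density (mu i) 1)"
begin

definition dev :: "'a \<Rightarrow> real" where
  "dev w = (\<Sum>i=1..k. (Y i w)\<^sup>2) - (real k + lam)"

text \<open>Half the variance of \<^term>\<open>dev\<close>.\<close>

definition D :: real where "D = real k + 2 * lam"

lemma lam_nonneg: "lam \<ge> 0"
  unfolding lam by (intro sum_nonneg) auto

lemma D_ge_1: "D \<ge> 1"
  using k lam_nonneg by (simp add: D_def)

lemma sum_mean: "(\<Sum>i=1..k. 1 + (mu i)\<^sup>2) = real k + lam"
  by (simp add: lam sum.distrib)

lemma sum_scale: "(\<Sum>i=1..k. c * (1 + 2 * (mu i)\<^sup>2) * r) = c * D * r"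
proof -
  have "(\<Sum>i=1..k. 1 + 2 * (mu i)\<^sup>2) = D"
    unfolding D_def unfolding lam by (simp add: sum.distrib sum_distrib_left[symmetric])
  then show ?thesis by (simp only: sum_distrib_left[symmetric] sum_distrib_right[symmetric])
qed

lemma Y_measurable [measurable]: "i \<in> {1..k} \<Longrightarrow> Y i \<in> borel_measurable N"
  using normal[of i] by (simp add: distributed_def)

lemma dev_measurable [measurable]: "dev \<in> borel_measurable N"
  unfolding dev_def by measurable

lemma dev_mgf:
  assumes t: "t < 1 / 2"
  shows "has_bochner_integral N (\<lambda>w. exp (t * dev w)) (exp (\<Sum>i=1..k. centred_square_cgf (mu i) t))"
proof -
  let ?f = "\<lambda>i y. exp (t * (y\<^sup>2 - (1 + (mu i)\<^sup>2)))"
  have "dev w = (\<Sum>i=1..k. (Y i w)\<^sup>2 - (1 + (mu i)\<^sup>2))" for w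
    by (simp only: dev_def sum_mean[symmetric] sum_subtractf)
  then have prod: "exp (t * dev w) = (\<Prod>i=1..k. ?f i (Y i w))" for w
    by (simp only: sum_distrib_left exp_sum finite_atLeastAtMost)
  have ind: "indep_vars (\<lambda>_. borel) (\<lambda>i w. ?f i (Y i w)) {1..k}"
    by (rule indep_vars_compose2[OF indep]) measurable
  have mgf: "has_bochner_integral N (\<lambda>w. ?f i (Y i w)) (exp (centred_square_cgf (mu i) t))"
    if "i \<in> {1..k}" for i
    by (rule gaussian_square_mgf[OF normal[OF that] t])
  then have int: "integrable N (\<lambda>w. ?f i (Y i w))" if "i \<in> {1..k}" for i
    using that by (auto simp: has_bochner_integral_iff)
  have "(\<integral>w. exp (t * dev w) \<partial>N) = (\<Prod>i=1..k. \<integral>w. ?f i (Y i w) \<partial>N)"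
    unfolding prod by (rule indep_vars_lebesgue_integral[OF _ ind int]) auto
  also have "\<dots> = (\<Prod>i=1..k. exp (centred_square_cgf (mu i) t))"
    by (intro prod.cong refl has_bochner_integral_integral_eq mgf)
  finally have "(\<integral>w. exp (t * dev w) \<partial>N) = exp (\<Sum>i=1..k. centred_square_cgf (mu i) t)"
    by (simp add: exp_sum)
  moreover have "integrable N (\<lambda>w. exp (t * dev w))"
    unfolding prod by (rule indep_vars_integrable[OF _ ind int]) auto
  ultimately show ?thesis by (simp add: has_bochner_integral_iff)
qed

lemma dev_mgf_lower:
  assumes "t < 1 / 2" "0 \<le> c" "c \<le> 1" "c * (1 - 2 * t) \<le> 1"
  shows "exp (c * D * t\<^sup>2) \<le> expectation (\<lambda>w. exp (t * dev w))"
proof -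
  have "c * D * t\<^sup>2 \<le> (\<Sum>i=1..k. centred_square_cgf (mu i) t)"
    unfolding sum_scale[symmetric] by (intro sum_mono centred_square_cgf_lower assms)
  then show ?thesis using dev_mgf[OF assms(1)] by (simp add: has_bochner_integral_iff)
qed

lemma dev_mgf_upper:
  assumes "t < 1 / 2" "1 \<le> c" "1 \<le> c * (1 - 2 * t)"
  shows "expectation (\<lambda>w. exp (t * dev w)) \<le> exp (c * D * t\<^sup>2)"
proof -
  have "(\<Sum>i=1..k. centred_square_cgf (mu i) t) \<le> c * D * t\<^sup>2"
    unfolding sum_scale[symmetric] by (intro sum_mono centred_square_cgf_upper assms)
  then show ?thesis using dev_mgf[OF assms(1)] by (simp add: has_bochner_integral_iff)
qed

lemma dev_exp_integrable: "t < 1 / 2 \<Longrightarrow> integrable N (\<lambda>w. exp (t * dev w))"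
  using dev_mgf by (auto simp: has_bochner_integral_iff)

lemma chernoff_upper_tail:
  assumes s: "0 < s" "s \<le> 1 / 4"
  shows "prob {w \<in> space N. dev w \<ge> x} \<le> exp (2 * D * s\<^sup>2 - s * x)"
proof -
  have "prob {w \<in> space N. dev w \<ge> x} \<le> exp (- s * x) * expectation (\<lambda>w. exp (s * dev w))"
    using s dev_exp_integrable[of s] by (intro chernoff_bound) (auto simp: has_bochner_integral_iff)
  also have "\<dots> \<le> exp (- s * x) * exp (2 * D * s\<^sup>2)"
    using s by (intro mult_left_mono dev_mgf_upper) auto
  finally show ?thesis by (simp add: exp_add[symmetric])
qed

lemma chernoff_lower_tail:
  assumes s: "0 < s"
  shows "prob {w \<in> space N. dev w \<le> - x} \<le> exp (D * s\<^sup>2 - s * x)"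
proof -
  have "prob {w \<in> space N. - dev w \<ge> x} \<le> exp (- s * x) * expectation (\<lambda>w. exp ((- s) * dev w))"
    using s dev_exp_integrable[of "- s"] by (intro chernoff_bound) (auto simp: has_bochner_integral_iff)
  also have "\<dots> \<le> exp (- s * x) * exp (1 * D * (- s)\<^sup>2)"
    using s by (intro mult_left_mono dev_mgf_upper) auto
  finally show ?thesis by (simp add: exp_add[symmetric] minus_le_iff le_minus_iff)
qed

lemma moderate_upper_tail:
  assumes "D \<ge> 768" "0 \<le> x" "x \<le> D / 48"
  shows "exp (- 44 - 126 * (x\<^sup>2 / D)) \<le> prob {w \<in> space N. dev w \<ge> x}"
  using assms
  by (intro reverse_chernoff dev_exp_integrable dev_mgf_lower dev_mgf_upper) auto

lemma moderate_lower_tail: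
  assumes "D \<ge> 768" "0 \<le> x" "x \<le> D / 48"
  shows "exp (- 44 - 126 * (x\<^sup>2 / D)) \<le> prob {w \<in> space N. dev w \<le> - x}"
proof -
  have "exp (- 44 - 126 * (x\<^sup>2 / D)) \<le> prob {w \<in> space N. - dev w \<ge> x}"
  proof (rule reverse_chernoff[OF assms])
    fix t :: real assume t: "0 < t" "t \<le> 1 / 4"
    show "integrable N (\<lambda>w. exp (t * - dev w))"
      using dev_exp_integrable[of "- t"] t by simp
    show "exp (2 / 3 * D * t\<^sup>2) \<le> expectation (\<lambda>w. exp (t * - dev w))"
      using dev_mgf_lower[of "- t" "2 / 3"] t by simp
    show "expectation (\<lambda>w. exp (t * - dev w)) \<le> exp (2 * D * t\<^sup>2)"
      using dev_mgf_upper[of "- t" 2] t by simp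
  qed
  then show ?thesis by (simp add: le_minus_iff)
qed

text \<open>One coordinate alone can exceed the whole threshold. The factor \<open>exp (- D)\<close> that this loses is
  harmless when \<open>D\<close> is bounded or \<open>x\<close> is at least of order \<open>D\<close>.\<close>

lemma crude_upper_tail:
  assumes "x \<ge> 0"
  shows "exp (- 3 - D - x) \<le> prob {w \<in> space N. dev w \<ge> x}"
proof -
  have "exp (- 3 - D - x) \<le> exp (- 3 - (real k + lam + x))"
    using lam_nonneg by (simp add: D_def)
  also have "\<dots> \<le> prob {w \<in> space N. (Y 1 w)\<^sup>2 \<ge> real k + lam + x}"
    using k lam_nonneg assms by (intro unit_normal_square_large[OF normal]) auto
  also have "\<dots> \<le> prob {w \<in> space N. dev w \<ge> x}"
  proof (rule finite_measure_mono)
    have "(Y 1 w)\<^sup>2 \<le> (\<Sum>i=1..k. (Y i w)\<^sup>2)" for w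
      using k by (intro member_le_sum) auto
    then show "{w \<in> space N. (Y 1 w)\<^sup>2 \<ge> real k + lam + x} \<subseteq> {w \<in> space N. dev w \<ge> x}"
      unfolding dev_def by (auto simp: algebra_simps intro: order_trans)
  qed measurable
  finally show ?thesis .
qed

text \<open>If every coordinate square is at most the fraction \<open>d\<close> of its mean then so is the sum, and
  independence multiplies the one-dimensional probabilities.\<close>

lemma crude_lower_tail:
  assumes d: "0 < d" "d \<le> 1" and x: "x \<le> (1 - d) * (real k + lam)"
  shows "exp (- ((3 + 1 / d) * D)) \<le> prob {w \<in> space N. dev w \<le> - x}"
proof -
  let ?A = "\<lambda>i. {y. y\<^sup>2 \<le> d * (1 + (mu i)\<^sup>2)} :: real set"
  have vimage: "Y i -` ?A i \<inter> space N = {w \<in> space N. (Y i w)\<^sup>2 \<le> d * (1 + (mu i)\<^sup>2)}" for i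
    by auto
  have "exp (- ((3 + 1 / d) * D)) = (\<Prod>i=1..k. exp (- ((3 + 1 / d) * (1 + 2 * (mu i)\<^sup>2))))"
    using sum_scale[of "3 + 1 / d" 1] by (simp add: exp_sum[symmetric] sum_negf)
  also have "\<dots> \<le> (\<Prod>i=1..k. prob (Y i -` ?A i \<inter> space N))"
    unfolding vimage by (intro prod_mono conjI exp_ge_zero unit_normal_square_small[OF normal] d)
  also have "\<dots> = prob (\<Inter>i\<in>{1..k}. Y i -` ?A i \<inter> space N)"
    using k by (intro indep_varsD[OF indep, symmetric]) auto
  also have "\<dots> \<le> prob {w \<in> space N. dev w \<le> - x}"
  proof (rule finite_measure_mono)
    show "(\<Inter>i\<in>{1..k}. Y i -` ?A i \<inter> space N) \<subseteq> {w \<in> space N. dev w \<le> - x}"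
    proof
      fix w assume w: "w \<in> (\<Inter>i\<in>{1..k}. Y i -` ?A i \<inter> space N)"
      have "w \<in> space N" using w k by auto
      have "(\<Sum>i=1..k. (Y i w)\<^sup>2) \<le> (\<Sum>i=1..k. d * (1 + (mu i)\<^sup>2))"
        using w by (intro sum_mono) auto
      also have "\<dots> = d * (real k + lam)" by (simp only: sum_distrib_left[symmetric] sum_mean)
      finally have "dev w \<le> - x" using x by (simp add: dev_def algebra_simps)
      then show "w \<in> {w \<in> space N. dev w \<le> - x}" using \<open>w \<in> space N\<close> by simp
    qed
  qed measurable
  finally show ?thesis .
qed

lemma upper_tail_le_gaussian:
  assumes "0 \<le> x" "x \<le> D"
  shows "prob {w \<in> space N. dev w \<ge> x} \<le> exp (- (1 / 8) * (x\<^sup>2 / D))"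
proof (cases "x = 0")
  case False
  then have "prob {w \<in> space N. dev w \<ge> x} \<le> exp (2 * D * (x / (4 * D))\<^sup>2 - x / (4 * D) * x)"
    using assms D_ge_1 by (intro chernoff_upper_tail) (auto simp: field_simps)
  also have "2 * D * (x / (4 * D))\<^sup>2 - x / (4 * D) * x = - (1 / 8) * (x\<^sup>2 / D)"
    using D_ge_1 by (simp add: field_simps power2_eq_square)
  finally show ?thesis .
qed simp

lemma upper_tail_le_exponential:
  assumes "x \<ge> D"
  shows "prob {w \<in> space N. dev w \<ge> x} \<le> exp (- (1 / 8) * x)"
proof -
  have "prob {w \<in> space N. dev w \<ge> x} \<le> exp (2 * D * (1 / 4)\<^sup>2 - 1 / 4 * x)"
    by (intro chernoff_upper_tail) auto
  also have "\<dots> \<le> exp (- (1 / 8) * x)" using assms by (simp add: power2_eq_square)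
  finally show ?thesis .
qed

lemma lower_tail_le_gaussian:
  assumes "0 < x"
  shows "prob {w \<in> space N. dev w \<le> - x} \<le> exp (- (1 / 4) * (x\<^sup>2 / D))"
proof -
  have "prob {w \<in> space N. dev w \<le> - x} \<le> exp (D * (x / (2 * D))\<^sup>2 - x / (2 * D) * x)"
    using assms D_ge_1 by (intro chernoff_lower_tail) auto
  also have "D * (x / (2 * D))\<^sup>2 - x / (2 * D) * x = - (1 / 4) * (x\<^sup>2 / D)"
    using D_ge_1 by (simp add: field_simps power2_eq_square)
  finally show ?thesis .
qed

text \<open>Beyond the range of \<open>reverse_chernoff\<close> this converts a loss of \<open>exp (- O(D))\<close> into the
  Gaussian rate; \<open>2304 = 48\<^sup>2\<close>.\<close>

lemma D_le_quadratic:
  assumes "x \<ge> D / 48"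
  shows "D \<le> 2304 * (x\<^sup>2 / D)"
proof -
  have "(D / 48)\<^sup>2 \<le> x\<^sup>2" using assms D_ge_1 by (intro power_mono) auto
  then show ?thesis using D_ge_1 by (simp add: field_simps power2_eq_square)
qed

text \<open>The constant \<open>1539 = 3 + 2 * 768\<close> is the cost of \<open>crude_upper_tail\<close> for \<open>x \<le> D < 768\<close>, and
  \<open>4608 = 2 * 2304\<close> that for \<open>D / 48 \<le> x \<le> D\<close>.\<close>

lemma upper_tail_ge_gaussian:
  assumes x: "0 \<le> x" "x \<le> D"
  shows "exp (- 1539) * exp (- 4608 * (x\<^sup>2 / D)) \<le> prob {w \<in> space N. dev w \<ge> x}"
proof -
  have nonneg: "x\<^sup>2 / D \<ge> 0" using D_ge_1 by simp
  consider "D < 768" | "x \<ge> D / 48" | "D \<ge> 768" "x \<le> D / 48" by linarith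
  then obtain e where e: "- 1539 - 4608 * (x\<^sup>2 / D) \<le> e" "exp e \<le> prob {w \<in> space N. dev w \<ge> x}"
  proof cases
    case 1
    then show thesis using that[OF _ crude_upper_tail] x nonneg by simp
  next
    case 2
    then show thesis using that[OF _ crude_upper_tail] D_le_quadratic[of x] x by simp
  next
    case 3
    then show thesis using that[OF _ moderate_upper_tail] x nonneg by simp
  qed
  have "exp (- 1539) * exp (- 4608 * (x\<^sup>2 / D)) \<le> exp e"
    using e(1) by (simp add: exp_add[symmetric])
  then show ?thesis using e(2) by simp
qed

lemma upper_tail_ge_exponential:
  assumes x: "x \<ge> D"
  shows "exp (- 3) * exp (- 2 * x) \<le> prob {w \<in> space N. dev w \<ge> x}"
proof -
  have "exp (- 3) * exp (- 2 * x) \<le> exp (- 3 - D - x)"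
    using x by (simp add: exp_add[symmetric])
  also have "\<dots> \<le> prob {w \<in> space N. dev w \<ge> x}"
    using x D_ge_1 by (intro crude_upper_tail) auto
  finally show ?thesis .
qed

text \<open>The prefactor must not depend on \<open>\<beta>\<close>, so \<open>\<beta>\<close> is used only for \<open>x \<ge> D / 48\<close>, where its whole
  cost goes into the rate. For smaller \<open>x\<close> one has \<open>x \<le> (k + \<lambda>) / 2\<close> because \<open>D \<le> 2 (k + \<lambda>)\<close>, and
  \<open>crude_lower_tail\<close> applies with \<open>d = 1/2\<close>; \<open>3840 = 5 * 768\<close> is its cost for \<open>D < 768\<close>.\<close>

lemma lower_tail_ge_gaussian:
  assumes \<beta>: "\<beta> > 1" and x: "0 < x" "x \<le> (real k + lam) / \<beta>"
  shows "exp (- 3840) * exp (- (2304 * (3 + \<beta> / (\<beta> - 1))) * (x\<^sup>2 / D))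
    \<le> prob {w \<in> space N. dev w \<le> - x}"
proof -
  define K where "K = 3 + \<beta> / (\<beta> - 1)"
  define q where "q = x\<^sup>2 / D"
  have q: "q \<ge> 0" using D_ge_1 by (simp add: q_def)
  have K: "K \<ge> 3" using \<beta> by (simp add: K_def)
  have Kq: "3 * q \<le> K * q" using K q by (intro mult_right_mono)
  consider "x \<ge> D / 48" | "x \<le> D / 48" "D < 768" | "x \<le> D / 48" "D \<ge> 768" by linarith
  then obtain e where e: "- 3840 - 2304 * (K * q) \<le> e" "exp e \<le> prob {w \<in> space N. dev w \<le> - x}"
  proof cases
    case 1
    have "exp (- ((3 + 1 / ((\<beta> - 1) / \<beta>)) * D)) \<le> prob {w \<in> space N. dev w \<le> - x}"
      using \<beta> x by (intro crude_lower_tail) (auto simp: field_simps)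
    moreover have "K * D \<le> K * (2304 * q)"
      unfolding q_def using 1 K by (intro mult_left_mono D_le_quadratic) auto
    ultimately show thesis using that[of "- (K * D)"] by (simp add: K_def mult_ac)
  next
    case 2
    have "exp (- ((3 + 1 / (1 / 2)) * D)) \<le> prob {w \<in> space N. dev w \<le> - x}"
      using 2 lam_nonneg by (intro crude_lower_tail) (auto simp: D_def)
    then show thesis using that[of "- (5 * D)"] 2 Kq q by simp
  next
    case 3
    have "exp (- 44 - 126 * q) \<le> prob {w \<in> space N. dev w \<le> - x}"
      unfolding q_def using 3 x by (intro moderate_lower_tail) auto
    then show thesis using that[of "- 44 - 126 * q"] Kq q by simp
  qed
  have "exp (- 3840) * exp (- (2304 * K) * q) \<le> exp e"
    using e(1) by (simp add: exp_add[symmetric] mult_ac)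
  then show ?thesis using e(2) by (simp add: K_def q_def)
qed

end

section \<open>Tails of the noncentral chi-squared law\<close>

lemma noncentral_chi2_lawE:
  assumes "noncentral_chi2_law k lam Q" "k \<ge> 1"
  obtains N :: "(nat \<Rightarrow> real) measure" and mu Y where "noncentral_chi2 N k mu Y lam"
    "\<And>x. measure Q {z. z - (real k + lam) \<ge> x}
      = measure N {w \<in> space N. noncentral_chi2.dev k Y lam w \<ge> x}"
    "\<And>x. measure Q {z. z - (real k + lam) \<le> x}
      = measure N {w \<in> space N. noncentral_chi2.dev k Y lam w \<le> x}"
proof -
  obtain mu and N :: "(nat \<Rightarrow> real) measure" and Y where *:
      "(\<Sum>i=1..k. (mu i)\<^sup>2) = lam" "prob_space N"
      "prob_space.indep_vars N (\<lambda>_. borel) Y {1..k}"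
      "\<forall>i\<in>{1..k}. distributed N lborel (Y i) (normal_density (mu i) 1)"
      and Q: "Q = distr N borel (\<lambda>w. \<Sum>i=1..k. (Y i w)\<^sup>2)"
    using assms(1) unfolding noncentral_chi2_law_def by metis
  interpret prob_space N by fact
  have chi2: "noncentral_chi2 N k mu Y lam"
    using * assms(2) by unfold_locales auto
  interpret noncentral_chi2 N k mu Y lam by (fact chi2)
  have "(\<lambda>w. \<Sum>i=1..k. (Y i w)\<^sup>2) \<in> borel_measurable N" by measurable
  then show thesis
    using that[OF chi2] by (simp add: Q upper_tail_distr lower_tail_distr dev_def)
qed

theorem theorem7:
  shows "\<exists>(c::real) (C::real) (cbar::real) (ct::real) (Ct::real) (c1::real) (Cb :: real \<Rightarrow> real).
    c > 0 \<and> C > 0 \<and> cbar > 0 \<and> ct > 0 \<and> Ct > 0 \<and> c1 > 0 \<and> (\<forall>\<beta>>1. Cb \<beta> > 0) \<and>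
    (\<forall>(k::nat) (lam::real) (Q :: real measure).
       k \<ge> 1 \<longrightarrow> lam \<ge> 0 \<longrightarrow> noncentral_chi2_law k lam Q \<longrightarrow>
       (let X = (\<lambda>z::real. z - (real k + lam)) in
        (\<forall>x::real. 0 \<le> x \<and> x \<le> real k + 2 * lam \<longrightarrow>
            c * exp (- C * (x\<^sup>2 / (real k + 2 * lam))) \<le> measure Q {z. X z \<ge> x} \<and>
            measure Q {z. X z \<ge> x} \<le> exp (- cbar * (x\<^sup>2 / (real k + 2 * lam)))) \<and>
        (\<forall>x::real. x \<ge> real k + 2 * lam \<longrightarrow>
            ct * exp (- Ct * x) \<le> measure Q {z. X z \<ge> x} \<and>
            measure Q {z. X z \<ge> x} \<le> exp (- cbar * x)) \<and>
        (\<forall>(\<beta>::real) (x::real). \<beta> > 1 \<and> 0 < x \<and> x \<le> (real k + lam) / \<beta> \<longrightarrow>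
            c1 * exp (- Cb \<beta> * (x\<^sup>2 / (real k + 2 * lam))) \<le> measure Q {z. X z \<le> - x} \<and>
            measure Q {z. X z \<le> - x} \<le> exp (- (1 / 4) * (x\<^sup>2 / (real k + 2 * lam))))))"
proof (intro exI conjI allI impI)
  fix k :: nat and lam :: real and Q :: "real measure"
  assume "noncentral_chi2_law k lam Q" "k \<ge> 1"
  then obtain N :: "(nat \<Rightarrow> real) measure" and mu Y where chi2: "noncentral_chi2 N k mu Y lam"
    and tails: "\<And>x. measure Q {z. z - (real k + lam) \<ge> x}
      = measure N {w \<in> space N. noncentral_chi2.dev k Y lam w \<ge> x}"
    "\<And>x. measure Q {z. z - (real k + lam) \<le> x}
      = measure N {w \<in> space N. noncentral_chi2.dev k Y lam w \<le> x}"
    by (rule noncentral_chi2_lawE) blast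
  interpret noncentral_chi2 N k mu Y lam by (fact chi2)
  show "let X = (\<lambda>z::real. z - (real k + lam)) in
        (\<forall>x::real. 0 \<le> x \<and> x \<le> real k + 2 * lam \<longrightarrow>
            exp (- 1539) * exp (- 4608 * (x\<^sup>2 / (real k + 2 * lam))) \<le> measure Q {z. X z \<ge> x} \<and>
            measure Q {z. X z \<ge> x} \<le> exp (- (1 / 8) * (x\<^sup>2 / (real k + 2 * lam)))) \<and>
        (\<forall>x::real. x \<ge> real k + 2 * lam \<longrightarrow>
            exp (- 3) * exp (- 2 * x) \<le> measure Q {z. X z \<ge> x} \<and>
            measure Q {z. X z \<ge> x} \<le> exp (- (1 / 8) * x)) \<and>
        (\<forall>(\<beta>::real) (x::real). \<beta> > 1 \<and> 0 < x \<and> x \<le> (real k + lam) / \<beta> \<longrightarrow>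
            exp (- 3840) * exp (- (2304 * (3 + \<beta> / (\<beta> - 1))) * (x\<^sup>2 / (real k + 2 * lam)))
              \<le> measure Q {z. X z \<le> - x} \<and>
            measure Q {z. X z \<le> - x} \<le> exp (- (1 / 4) * (x\<^sup>2 / (real k + 2 * lam))))"
    unfolding Let_def tails D_def[symmetric]
    using upper_tail_ge_gaussian upper_tail_le_gaussian upper_tail_ge_exponential
      upper_tail_le_exponential lower_tail_ge_gaussian lower_tail_le_gaussian
    by blast
next
  fix \<beta> :: real assume "\<beta> > 1"
  then show "2304 * (3 + \<beta> / (\<beta> - 1)) > 0" by (simp add: add_pos_pos)
qed simp_all

end
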